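(* For every $n\in\mathbb N=\{1,2,3,\dots\}$, the minimal polynomial $C(n,x)$ over $\mathbb Q$ of the algebraic number $\rho(n)=2\cos(\pi/n)$ is a monic polynomial with integer coefficients.
   Context: The minimal polynomial of an algebraic number $\alpha$ is the monic polynomial of least degree in $\mathbb Q[x]$ having $\alpha$ as a root. *)

theory Defs
  imports "HOL-Computational_Algebra.Computational_Algebra" Complex_Main
begin

definition is_min_poly :: "rat poly \<Rightarrow> 'a :: field_char_0 \<Rightarrow> bool" where
  "is_min_poly p x \<longleftrightarrow>
     lead_coeff p = 1 \<and> poly (map_poly of_rat p) x = 0 \<and>
     (\<forall>q. lead_coeff q = 1 \<and> poly (map_poly of_rat q) x = 0 \<longrightarrow> degree p \<le> degree q)"

(* Meaningful for algebraic x only: see is_min_poly_min_poly. *)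
definition min_poly :: "'a :: field_char_0 \<Rightarrow> rat poly" where
  "min_poly x = (THE p. is_min_poly p x)"

definition rho :: "nat \<Rightarrow> real" where
  "rho n = 2 * cos (pi / real n)"

definition C :: "nat \<Rightarrow> rat poly" where
  "C n = min_poly (rho n)"

lemma is_min_poly_unique:
  fixes x :: "'a :: field_char_0"
  assumes p: "is_min_poly p x" and q: "is_min_poly q x"
  shows "p = q"
proof (rule ccontr)
  assume neq: "p \<noteq> q"
  define r where "r = p - q"
  define s where "s = smult (inverse (lead_coeff r)) r"
  have r0: "r \<noteq> 0" using neq by (simp add: r_def)
  have pm: "lead_coeff p = 1" and pr: "poly (map_poly of_rat p) x = 0"
    using p by (auto simp: is_min_poly_def)
  have qm: "lead_coeff q = 1" and qr: "poly (map_poly of_rat q) x = 0"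
    using q by (auto simp: is_min_poly_def)
  have deg: "degree p = degree q"
    using p q unfolding is_min_poly_def by (meson order_antisym)
  have "(map_poly of_rat r :: 'a poly) = map_poly of_rat p - map_poly of_rat q"
    by (intro poly_eqI) (simp add: coeff_map_poly r_def of_rat_diff)
  moreover have "(map_poly of_rat s :: 'a poly) =
      smult (of_rat (inverse (lead_coeff r))) (map_poly of_rat r)"
    by (intro poly_eqI) (simp add: coeff_map_poly s_def of_rat_mult)
  ultimately have sr: "poly (map_poly of_rat s) x = 0"
    by (simp add: pr qr)
  have "lead_coeff s = 1" using r0 by (simp add: s_def)
  with sr p have "degree p \<le> degree s" by (auto simp: is_min_poly_def)
  also have "degree s = degree r" using r0 by (simp add: s_def)
  finally have le: "degree p \<le> degree r" .
  have "degree r \<le> degree p" unfolding r_def using deg by (simp add: degree_diff_le)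
  with le have "degree r = degree p" by simp
  then have "lead_coeff r = 0" using pm qm deg by (simp add: r_def)
  with r0 show False by simp
qed

lemma is_min_poly_min_poly:
  fixes x :: "'a :: field_char_0"
  assumes "algebraic x"
  shows "is_min_poly (min_poly x) x"
proof -
  define P where "P = (\<lambda>p :: rat poly. lead_coeff p = 1 \<and> poly (map_poly of_rat p) x = 0)"
  obtain p0 :: "'a poly" where p0: "\<And>i. coeff p0 i \<in> \<rat>" "p0 \<noteq> 0" "poly p0 x = 0"
    using assms unfolding algebraic_altdef by auto
  obtain q where q: "p0 = map_poly of_rat q"
    using ratpolyE[of p0] p0(1) by auto
  define s where "s = smult (inverse (lead_coeff q)) q"
  have q0: "q \<noteq> 0" using q p0(2) by auto
  have "(map_poly of_rat s :: 'a poly) = smult (of_rat (inverse (lead_coeff q))) p0"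
    by (intro poly_eqI) (simp add: coeff_map_poly s_def of_rat_mult q)
  then have "P s" using p0(3) q0 by (simp add: P_def s_def)
  then have min: "is_min_poly (arg_min degree P) x"
    using arg_min_nat_lemma[of P s degree] unfolding is_min_poly_def P_def by blast
  show ?thesis
    unfolding min_poly_def using min is_min_poly_unique[OF _ min] by (rule theI)
qed

end

(* The number 2 cos (pi / n) is an algebraic integer: the monic integer polynomial V_n with
   V_n (2 cos t) = 2 cos (n t), shifted by 2, vanishes there. By Gauss's lemma every monic rational
   factor of a monic integer polynomial has integer coefficients, and the minimal polynomial of an
   algebraic integer is such a factor. *)
theory Submission
  imports Defs
begin

lemma map_poly_of_rat_add:
  "(map_poly of_rat (p + q) :: 'a :: field_char_0 poly) = map_poly of_rat p + map_poly of_rat q"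
  by (intro poly_eqI) (simp add: coeff_map_poly of_rat_add)

lemma map_poly_of_rat_mult:
  "(map_poly of_rat (p * q) :: 'a :: field_char_0 poly) = map_poly of_rat p * map_poly of_rat q"
  by (intro poly_eqI) (simp add: coeff_map_poly coeff_mult of_rat_sum of_rat_mult)

lemma map_poly_of_int_mult:
  "(map_poly of_int (p * q) :: 'a :: {comm_ring_1, ring_char_0} poly) =
     map_poly of_int p * map_poly of_int q"
  by (intro poly_eqI) (simp add: coeff_map_poly coeff_mult)

text \<open>Division with remainder: \<open>q mod p\<close> also vanishes at \<open>x\<close>, and
  if it were nonzero, its monic multiple \<open>s\<close> would have degree below that of
  \<open>p\<close>, against minimality.\<close>

lemma is_min_poly_dvd:
  fixes x :: "'a :: field_char_0"
  assumes p: "is_min_poly p x" and q: "poly (map_poly of_rat q) x = 0"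
  shows "p dvd q"
proof (rule ccontr)
  assume "\<not> p dvd q"
  define r where "r = q mod p"
  define s where "s = smult (inverse (lead_coeff r)) r"
  have r0: "r \<noteq> 0" using \<open>\<not> p dvd q\<close> by (simp add: r_def dvd_eq_mod_eq_0)
  have p0: "p \<noteq> 0" using p by (auto simp: is_min_poly_def)
  have "q = q div p * p + r" by (simp add: r_def)
  then have "poly (map_poly of_rat q) x =
      poly (map_poly of_rat (q div p)) x * poly (map_poly of_rat p) x + poly (map_poly of_rat r) x"
    by (metis map_poly_of_rat_add map_poly_of_rat_mult poly_add poly_mult)
  then have "poly (map_poly of_rat r) x = 0"
    using p q by (simp add: is_min_poly_def)
  moreover have "s = [:inverse (lead_coeff r):] * r" by (simp add: s_def)
  ultimately have "poly (map_poly of_rat s) x = 0"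
    by (simp only: map_poly_of_rat_mult poly_mult mult_zero_right)
  moreover have "lead_coeff s = 1" using r0 by (simp add: s_def)
  ultimately have "degree p \<le> degree s" using p by (auto simp: is_min_poly_def)
  also have "degree s = degree r" using r0 by (simp add: s_def)
  also have "degree r < degree p"
    using degree_mod_less[OF p0, of q] r0 by (auto simp: r_def)
  finally show False by simp
qed

lemma rat_poly_common_denominator:
  fixes p :: "rat poly"
  obtains d :: int and q :: "int poly" where "d > 0" "smult (of_int d) p = map_poly of_int q"
proof -
  have "\<exists>d > 0. \<exists>q :: int poly. smult (of_int d) p = map_poly of_int q"
  proof (induction p)
    case 0
    have "smult (of_int 1) 0 = map_poly rat_of_int 0" by simp
    then show ?case by (metis zero_less_one)
  next
    case (pCons c p)
    then obtain d q where d: "d > 0" and q: "smult (of_int d) p = map_poly of_int q" by auto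
    obtain a b where "quotient_of c = (a, b)" by fastforce
    then have b: "b > 0" and c: "c = of_int a / of_int b"
      using quotient_of_denom_pos quotient_of_div by auto
    \<comment> \<open>As \<open>c\<close> is \<open>a / b\<close>, scaling by \<open>d * b\<close>
      turns it into \<open>d * a\<close>; the other coefficients, already integral after scaling by
      \<open>d\<close>, only pick up the factor \<open>b\<close>.\<close>
    have "smult (of_int (d * b)) (pCons c p) = map_poly of_int (pCons (d * a) (smult b q))"
    proof -
      have "smult (of_int (d * b)) p = smult (of_int b) (smult (of_int d) p)"
        by (simp add: mult.commute)
      also have "\<dots> = map_poly of_int (smult b q)"
        unfolding q by (intro poly_eqI) (simp add: coeff_map_poly)
      finally have "smult (of_int (d * b)) p = map_poly of_int (smult b q)" .
      then show ?thesis using b by (simp add: map_poly_pCons c)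
    qed
    then show ?case using b d by (metis mult_pos_pos)
  qed
  then show ?thesis using that by blast
qed

text \<open>Gauss's lemma through contents. Clearing denominators in \<open>p\<close> and its
  cofactor \<open>r\<close> by \<open>a\<close> and \<open>b\<close> gives integer polynomials whose
  contents multiply to \<open>a * b\<close>. Since \<open>r\<close> is monic, \<open>b\<close> is a
  coefficient of \<open>r'\<close>, so \<open>content r'\<close> divides \<open>b\<close>; this
  forces \<open>a\<close> to divide \<open>content p'\<close>, and dividing \<open>p'\<close> by
  \<open>a\<close> returns \<open>p\<close>.\<close>

lemma monic_rat_dvd_monic_int:
  fixes p :: "rat poly" and P :: "int poly"
  assumes P: "lead_coeff P = 1" and p: "lead_coeff p = 1" and dvd: "p dvd map_poly of_int P"
  shows "coeff p i \<in> \<int>"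
proof -
  from dvd obtain r where r: "map_poly of_int P = p * r" by (elim dvdE)
  obtain a p' where a: "a > 0" "smult (of_int a) p = map_poly of_int p'"
    by (rule rat_poly_common_denominator)
  obtain b r' where b: "b > 0" "smult (of_int b) r = map_poly of_int r'"
    by (rule rat_poly_common_denominator)
  have cp: "rat_of_int (coeff p' j) = of_int a * coeff p j" for j
    using arg_cong[OF a(2), of "\<lambda>f. coeff f j"] by (simp add: coeff_map_poly)
  have cr: "rat_of_int (coeff r' j) = of_int b * coeff r j" for j
    using arg_cong[OF b(2), of "\<lambda>f. coeff f j"] by (simp add: coeff_map_poly)
  have "lead_coeff (map_poly rat_of_int P) = 1"
    using P by (simp add: degree_map_poly coeff_map_poly)
  then have lr: "lead_coeff r = 1" using p by (simp add: r lead_coeff_mult)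
  have "rat_of_int (coeff p' (degree p)) = of_int a" using cp p by simp
  then have "coeff p' (degree p) = a" by simp
  then have pa: "content p' dvd a" by (metis content_dvd_coeff)
  have "rat_of_int (coeff r' (degree r)) = of_int b" using cr lr by simp
  then have "coeff r' (degree r) = b" by simp
  then have rb: "content r' dvd b" by (metis content_dvd_coeff)
  have "map_poly rat_of_int (p' * r') = smult (of_int (a * b)) (p * r)"
    unfolding map_poly_of_int_mult a(2)[symmetric] b(2)[symmetric] by (simp add: mult.commute)
  also have "\<dots> = map_poly of_int (smult (a * b) P)"
    unfolding r[symmetric] by (intro poly_eqI) (simp add: coeff_map_poly)
  finally have "p' * r' = smult (a * b) P"
    by (simp add: poly_eq_iff coeff_map_poly flip: of_int_mult)
  moreover have "content P = 1"
    using P by (metis content_dvd_coeff is_unit_content_iff)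
  \<comment> \<open>The content of \<open>smult (a * b) P\<close> is the absolute value of
    \<open>a * b\<close>, which positivity of \<open>a\<close> and \<open>b\<close> removes.\<close>
  ultimately have prod: "content p' * content r' = a * b"
    using a(1) b(1) by (metis abs_of_pos content_mult content_smult mult.right_neutral mult_pos_pos
        normalize_int_def)
  have "a dvd content p'"
  proof -
    from rb obtain k where "b = content r' * k" ..
    \<comment> \<open>The factor \<open>content r'\<close> cancels from \<open>prod\<close>; it is
      nonzero because \<open>b > 0\<close>.\<close>
    then have "content p' = a * k" using prod b(1)
      by (metis less_irrefl mult.assoc mult.commute mult_cancel_right mult_zero_left)
    then show ?thesis by simp
  qed
  then have "a dvd coeff p' i" using content_dvd_coeff dvd_trans by blast
  then obtain k where "coeff p' i = a * k" ..
  then have "of_int a * coeff p i = of_int a * of_int k" using cp[of i] by (metis of_int_mult)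
  then have "coeff p i = of_int k" using a(1) by simp
  then show ?thesis by simp
qed

lemma is_min_poly_algebraic_int:
  fixes x :: "'a :: field_char_0"
  assumes "algebraic_int x" and p: "is_min_poly p x"
  shows "coeff p i \<in> \<int>"
proof -
  from assms(1) obtain P :: "int poly" where P: "poly (map_poly of_int P) x = 0" "lead_coeff P = 1"
    by (auto simp: algebraic_int_altdef_ipoly)
  have "map_poly of_rat (map_poly of_int P) = (map_poly of_int P :: 'a poly)"
    by (intro poly_eqI) (simp add: coeff_map_poly)
  then have "p dvd map_poly of_int P" using is_min_poly_dvd[OF p] P(1) by simp
  then show ?thesis using monic_rat_dvd_monic_int[OF P(2)] p by (simp add: is_min_poly_def)
qed

text \<open>The rescaled Chebyshev polynomial \<open>2 T\<^sub>n(x / 2)\<close>, monic only for \<open>n > 0\<close>.\<close>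

fun monic_cheb :: "nat \<Rightarrow> 'a :: comm_ring_1 poly" where
  "monic_cheb 0 = [:2:]"
| "monic_cheb (Suc 0) = [:0, 1:]"
| "monic_cheb (Suc (Suc n)) = pCons 0 (monic_cheb (Suc n)) - monic_cheb n"

text \<open>At \<open>2 * cos t\<close> the recursion becomes the identity cos((n+2)t) = 2 cos(t)
  cos((n+1)t) - cos(nt), doubled.\<close>

lemma poly_monic_cheb_cos: "poly (monic_cheb n) (2 * cos t) = 2 * cos (real n * t)"
proof (induction n rule: monic_cheb.induct)
  case (3 n)
  have "cos (real (Suc (Suc n)) * t) + cos (real n * t) = 2 * cos t * cos (real (Suc n) * t)"
    using cos_add[of "real (Suc n) * t" t] cos_diff[of "real (Suc n) * t" t]
    by (simp add: algebra_simps)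
  then show ?case using 3 by (simp add: algebra_simps)
qed auto

lemma coeff_monic_cheb_int: "coeff (monic_cheb n) i \<in> \<int>"
  by (induction n arbitrary: i rule: monic_cheb.induct)
    (auto simp: coeff_pCons split: nat.splits)

lemma monic_cheb_monic:
  "degree (monic_cheb (Suc n) :: 'a :: comm_ring_1 poly) = Suc n \<and>
   coeff (monic_cheb (Suc n) :: 'a poly) (Suc n) = 1"
proof -
  \<comment> \<open>This bound on the degree ensures that the subtracted \<open>monic_cheb n\<close>
    cannot disturb the leading coefficient, which \<open>pCons 0\<close> merely shifts up by
    one.\<close>
  have above: "coeff (monic_cheb n :: 'a poly) i = 0" if "i > n" for n i
    using that by (induction n arbitrary: i rule: monic_cheb.induct)
      (auto simp: coeff_pCons split: nat.splits)
  have top: "coeff (monic_cheb (Suc n) :: 'a poly) (Suc n) = 1" for n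
    by (induction n) (auto simp: above)
  have "degree (monic_cheb (Suc n) :: 'a poly) \<le> Suc n"
    by (intro degree_le) (use above in blast)
  moreover have "degree (monic_cheb (Suc n) :: 'a poly) \<ge> Suc n"
    by (intro le_degree) (simp only: top one_neq_zero not_False_eq_True)
  ultimately show ?thesis using top by simp
qed

lemma algebraic_int_rho:
  assumes "n \<ge> 1"
  shows "algebraic_int (rho n)"
proof (rule algebraic_int.intros)
  \<comment> \<open>With t = pi/n the value of \<open>monic_cheb n\<close> at \<open>rho n\<close>
    is 2 cos(pi) = -2, hence the shift by 2. As n is positive, the constant changes neither the
    degree nor the leading coefficient.\<close>
  define p :: "real poly" where "p = monic_cheb n + [:2:]"
  obtain m where n: "n = Suc m" using assms by (cases n) auto
  have "degree p = n" and "coeff p n = 1"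
    using monic_cheb_monic[of m, where ?'a = real] unfolding p_def n
    by (simp_all add: degree_add_eq_left)
  then show "lead_coeff p = 1" by simp
  show "\<forall>i. coeff p i \<in> \<int>"
    by (auto simp: p_def coeff_monic_cheb_int coeff_pCons split: nat.splits)
  show "poly p (rho n) = 0"
    using assms by (simp add: p_def rho_def poly_monic_cheb_cos)
qed

theorem proposition2:
  fixes n :: nat
  assumes "n \<ge> 1"
  shows "algebraic (rho n) \<and> lead_coeff (C n) = 1 \<and> (\<forall>i. coeff (C n) i \<in> \<int>)"
proof -
  have int: "algebraic_int (rho n)" using assms by (rule algebraic_int_rho)
  \<comment> \<open>Algebraicity guarantees that the definite description behind \<open>C n\<close>
    denotes an actual minimal polynomial.\<close>
  then have alg: "algebraic (rho n)" by blast
  have "is_min_poly (C n) (rho n)" unfolding C_def using alg by (rule is_min_poly_min_poly)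
  then show ?thesis
    using alg is_min_poly_algebraic_int[OF int] by (auto simp: is_min_poly_def)
qed

end
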